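(* Let $1\le s\le N-1$ and let $j\ge1$ be an integer. Let $a'$ be a positive rational number with $a'\equiv s\deg(f)/N-j\pmod p$, and set $c'=a'+1-s/N$. For every integer $l$ with $\left\lceil\frac jp-1\right\rceil\le l\le\left\lfloor\frac{n'_s\deg(f)+j}{p}-1\right\rfloor$, put $d'=n'_s\deg(f)-(l+1)p+j$. Then $$\gamma_{s,(l+1)p-j}=\frac{(c';d')}{(a';d')}\,\mathcal F^{(d';n'_s,\dots,n'_s)}\Bigl(a',\underbrace{s/N,\dots,s/N}_{-1+\sum_{k\ge1}A_k},c';\underbrace{1,\dots,1}_{A_1-1},\underbrace{\lambda_2,\dots,\lambda_2}_{A_2},\dots,\underbrace{\lambda_r,\dots,\lambda_r}_{A_r}\Bigr),$$ where the right-hand side, a priori a polynomial in $\lambda_2,\dots,\lambda_r$ with coefficients in $\mathbb Q$ (obtained before reduction by treating $\lambda_2,\dots,\lambda_r$ as indeterminates; the denominators of its coefficients are coprime to $p$), is considered as a polynomial over $\mathbb F_p$.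
   Context: Let $K$ be a perfect field of characteristic $p>0$, $N\ge1$ an integer not divisible by $p$, and $$f(x)=x^{A_0}(x-1)^{A_1}\prod_{k=2}^r(x-\lambda_k)^{A_k}\in K[x]$$ with integers $A_i\ge1$, $\gcd(N,A_0,\dots,A_r)=1$, and $0,1,\lambda_2,\dots,\lambda_r\in\overline K$ pairwise distinct (so $\deg(f)=\sum_{k=0}^rA_k$). For $1\le s\le N-1$, let $m'_s,n'_s$ be the unique integers with $1\le m'_s\le N-1$, $0\le n'_s<p$ and $m'_sp-n'_sN=s$. The elements $\gamma_{s,e}$ are the coefficients in $f(x)^{n'_s}=\sum_{e}\gamma_{s,e}x^e$. Put $(x;n)=\prod_{i=1}^n(x+n-i)=x(x+1)\cdots(x+n-1)$. The Appell–Lauricella hypergeometric series is $$\mathcal F(a,b_2,\dots,b_R,c;z_2,\dots,z_R)=\sum_{n_2,\dots,n_R\ge0}\frac{(a;\sum_k n_k)\prod_k(b_k;n_k)}{(c;\sum_k n_k)\prod_k(1;n_k)}\prod_{k=2}^Rz_k^{n_k}.$$ For $(\sigma,\tau_1,\dots,\tau_R)\in\mathbb Z^{R+1}$, its truncation $\mathcal F^{(\sigma;\tau_1,\dots,\tau_R)}(a,b_2,\dots,b_R,c;z_2,\dots,z_R)$ is the sum of the $z_2^{e_2}\cdots z_R^{e_R}$-terms with $e_k\le\tau_k$ for $k=2,\dots,R$ and $\sigma-\tau_1\le\sum_{k=2}^Re_k\le\sigma$. In the claim $R=\sum_{k\ge1}A_k$, all $\tau_1,\dots,\tau_R$ equal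 $n'_s$, and the truncation is formed with independent variables $z_2,\dots,z_R$ which are then specialized to the indicated values. A congruence modulo $p$ between rational numbers is understood in the ring of rationals with denominator coprime to $p$ (so $a'$ has denominator coprime to $p$). *)

theory Defs
  imports
    "HOL-Algebra.Algebraic_Closure_Type"
    "HOL-Library.Poly_Mapping"
begin

definition perfect_field :: "'k::field itself \<Rightarrow> bool" where
  "perfect_field _ \<longleftrightarrow> CHAR('k) = 0 \<or> surj (\<lambda>x :: 'k. x ^ CHAR('k))"

text \<open>The integer \<open>n'\<^sub>s\<close>; the accompanying \<open>m'\<^sub>s\<close> is the witness \<open>m\<close>.\<close>

definition n_prime :: "nat \<Rightarrow> nat \<Rightarrow> nat \<Rightarrow> nat" where
  "n_prime p N s = (THE n. n < p \<and>
     (\<exists>m. 1 \<le> m \<and> m \<le> N - 1 \<and> int m * int p - int n * int N = int s))"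


subsection \<open>Rational numbers with denominator coprime to \<open>p\<close>\<close>

definition p_integral :: "nat \<Rightarrow> rat \<Rightarrow> bool" where
  "p_integral p q \<longleftrightarrow> coprime (snd (quotient_of q)) (int p)"

definition rat_cong :: "nat \<Rightarrow> rat \<Rightarrow> rat \<Rightarrow> bool" where
  "rat_cong p x y \<longleftrightarrow> p_integral p x \<and> p_integral p y \<and>
     (\<exists>t. p_integral p t \<and> x - y = of_nat p * t)"

text \<open>
  Reduction of a \<open>p\<close>-integral rational number to the prime field of a field of
  characteristic \<open>p\<close>. (Junk value \<open>0\<close> if the denominator is divisible by \<open>p\<close>.)
\<close>

definition red_rat :: "rat \<Rightarrow> 'a::field" where
  "red_rat q = of_int (fst (quotient_of q)) / of_int (snd (quotient_of q))"


subsection \<open>Multivariate polynomials\<close>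

text \<open>
  A polynomial in indeterminates indexed by \<open>nat\<close> is a finitely supported map from
  exponent vectors to coefficients; the ring operations are those of
  \<^theory>\<open>HOL-Library.Poly_Mapping\<close>.
\<close>

type_synonym 'a mpol = "(nat \<Rightarrow>\<^sub>0 nat) \<Rightarrow>\<^sub>0 'a"

definition mconst :: "'a::zero \<Rightarrow> 'a mpol" where
  "mconst c = Poly_Mapping.single 0 c"

definition mvar :: "nat \<Rightarrow> 'a::zero_neq_one mpol" where
  "mvar k = Poly_Mapping.single (Poly_Mapping.single k 1) 1"

text \<open>Apply \<open>h\<close> to the coefficients and substitute \<open>v k\<close> for the \<open>k\<close>-th indeterminate.\<close>

definition msubst :: "('b::zero \<Rightarrow> 'a::comm_semiring_1) \<Rightarrow> (nat \<Rightarrow> 'a) \<Rightarrow> 'b mpol \<Rightarrow> 'a" where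
  "msubst h v P = (\<Sum>e\<in>Poly_Mapping.keys P. h (Poly_Mapping.lookup P e) *
     (\<Prod>k\<in>Poly_Mapping.keys e. v k ^ Poly_Mapping.lookup e k))"


subsection \<open>Truncated Appell--Lauricella series\<close>

text \<open>
  \<open>AL_coeff R a b c e\<close> is the coefficient of \<open>\<Prod>k=2..R. z\<^sub>k ^ e\<^sub>k\<close> in the series
  \<open>\<F>(a, b\<^sub>2, \<dots>, b\<^sub>R, c; z\<^sub>2, \<dots>, z\<^sub>R)\<close>; \<open>(x; n)\<close> is \<^term>\<open>pochhammer x n\<close>.
\<close>

definition AL_coeff :: "nat \<Rightarrow> rat \<Rightarrow> (nat \<Rightarrow> rat) \<Rightarrow> rat \<Rightarrow> (nat \<Rightarrow>\<^sub>0 nat) \<Rightarrow> rat" where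
  "AL_coeff R a b c e =
     (pochhammer a (\<Sum>k=2..R. Poly_Mapping.lookup e k) *
      (\<Prod>k=2..R. pochhammer (b k) (Poly_Mapping.lookup e k))) /
     (pochhammer c (\<Sum>k=2..R. Poly_Mapping.lookup e k) *
      (\<Prod>k=2..R. pochhammer 1 (Poly_Mapping.lookup e k)))"

definition AL_trunc_exps :: "nat \<Rightarrow> int \<Rightarrow> (nat \<Rightarrow> int) \<Rightarrow> (nat \<Rightarrow>\<^sub>0 nat) set" where
  "AL_trunc_exps R \<sigma> \<tau> = {e. Poly_Mapping.keys e \<subseteq> {2..R} \<and>
     (\<forall>k\<in>{2..R}. int (Poly_Mapping.lookup e k) \<le> \<tau> k) \<and>
     \<sigma> - \<tau> 1 \<le> int (\<Sum>k=2..R. Poly_Mapping.lookup e k) \<and>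
     int (\<Sum>k=2..R. Poly_Mapping.lookup e k) \<le> \<sigma>}"

definition AL_trunc ::
  "nat \<Rightarrow> int \<Rightarrow> (nat \<Rightarrow> int) \<Rightarrow> rat \<Rightarrow> (nat \<Rightarrow> rat) \<Rightarrow> rat \<Rightarrow> rat mpol" where
  "AL_trunc R \<sigma> \<tau> a b c =
     (\<Sum>e\<in>AL_trunc_exps R \<sigma> \<tau>. Poly_Mapping.single e (AL_coeff R a b c e))"

text \<open>
  The list of length \<open>(\<Sum>k=1..r. A k) - 1\<close> of the arguments substituted for
  \<open>z\<^sub>2, z\<^sub>3, \<dots>\<close>: \<open>A 1 - 1\<close> copies of \<open>1\<close>, then \<open>A k\<close> copies of the indeterminate
  with index \<open>k\<close> (standing for \<open>\<lambda>\<^sub>k\<close>), for \<open>k = 2, \<dots>, r\<close>.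
\<close>

definition AL_args :: "(nat \<Rightarrow> nat) \<Rightarrow> nat \<Rightarrow> rat mpol list" where
  "AL_args A r = replicate (A 1 - 1) 1 @ concat (map (\<lambda>k. replicate (A k) (mvar k)) [2..<r + 1])"

end

theory Submission
  imports Defs
begin

text \<open>
  The coefficient of \<open>x ^ M\<close> in \<open>f ^ n'\<close> is the coefficient of \<open>x ^ d'\<close>, where
  \<open>M + d' = n' deg f\<close>, in the reversed polynomial, a product of \<open>R\<close> factors
  \<open>(1 - z\<^sub>i x) ^ n'\<close> with \<open>z\<^sub>1 = 1\<close>. Expanding by the binomial theorem and
  eliminating \<open>e\<^sub>1 = d' - S\<close> with \<open>S = e\<^sub>2 + \<dots> + e\<^sub>R\<close> gives a sum over exactly the
  exponents of the truncated series. Modulo \<open>p\<close> one has \<open>s/N = -n'\<close> and \<open>a' = -d'\<close>,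
  hence \<open>(s/N; e) / (1; e) = (-1) ^ e (n' choose e)\<close> for \<open>e < p\<close>, and likewise
  \<open>(c' + S; d' - S) / (a' + S; d' - S) = (-1) ^ (d' - S) (n' choose (d' - S))\<close>.
  So the coefficients agree term by term.
\<close>

subsection \<open>Reduction of rational numbers modulo \<open>p\<close>\<close>

text \<open>\<open>quotient_of\<close> yields lowest terms, so cross-multiplication and coprimality
  force its denominator to divide any other one. Hence p-integrality and reduction can be read off
  an arbitrary representation.\<close>

lemma
  assumes uv: "quotient_of (of_int a / of_int b) = (u, v)" and b: "b \<noteq> 0"
  shows quotient_of_divide_cross_mult: "a * v = u * b"
    and quotient_of_divide_dvd: "v dvd b"
proof -
  have "v > 0" using quotient_of_denom_pos[OF uv] .
  moreover have "(of_int a / of_int b :: rat) = of_int u / of_int v"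
    using quotient_of_div[OF uv] .
  ultimately have "(of_int (a * v) :: rat) = of_int (u * b)"
    using b by (simp add: field_simps)
  then show eq: "a * v = u * b" unfolding of_int_eq_iff .
  then have "v dvd u * b" by (metis dvd_triv_right)
  then show "v dvd b"
    using quotient_of_coprime[OF uv] by (simp add: coprime_commute coprime_dvd_mult_right_iff)
qed

section \<open>The ring of p-integral rationals\<close>

lemma p_integralI:
  assumes "prime p" and "\<not> int p dvd b"
  shows "p_integral p (of_int a / of_int b)"
proof -
  obtain u v where uv: "quotient_of (of_int a / of_int b) = (u, v)"
    by fastforce
  have "b \<noteq> 0" using assms by auto
  then have "\<not> int p dvd v"
    using quotient_of_divide_dvd[OF uv] assms(2) dvd_trans by blast
  then have "coprime (int p) v" using assms(1) by (simp add: prime_imp_coprime)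
  then show ?thesis unfolding p_integral_def uv by (simp add: coprime_commute)
qed

lemma p_integralE:
  assumes "prime p" and "p_integral p q"
  obtains a b where "\<not> int p dvd b" and "q = of_int a / of_int b"
proof -
  obtain u v where uv: "quotient_of q = (u, v)" by fastforce
  have "\<not> int p dvd v"
    using assms coprime_common_divisor[of v "int p" "int p"]
    by (auto simp: p_integral_def uv)
  then show ?thesis using that quotient_of_div[OF uv] by blast
qed

lemma p_integral_of_int [simp]: "p_integral p (of_int a)"
  by (simp add: p_integral_def)

lemma p_integral_of_nat [simp]: "p_integral p (of_nat a)"
  by (simp add: p_integral_def)

lemma p_integral_0 [simp]: "p_integral p 0" and p_integral_1 [simp]: "p_integral p 1"
  using p_integral_of_nat[of p 0] p_integral_of_nat[of p 1] by simp_all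

lemma p_integral_add:
  assumes "prime p" and "p_integral p x" and "p_integral p y"
  shows "p_integral p (x + y)"
proof -
  obtain a b where b: "\<not> int p dvd b" "x = of_int a / of_int b"
    using p_integralE[OF assms(1,2)] .
  obtain c d where d: "\<not> int p dvd d" "y = of_int c / of_int d"
    using p_integralE[OF assms(1,3)] .
  have "b \<noteq> 0" "d \<noteq> 0" using b(1) d(1) by auto
  then have eq: "x + y = of_int (a * d + c * b) / of_int (b * d)"
    unfolding b(2) d(2) by (simp add: add_frac_eq)
  have "\<not> int p dvd b * d"
    using assms(1) b(1) d(1) by (simp add: prime_dvd_mult_iff)
  then show ?thesis
    unfolding eq by (rule p_integralI[OF assms(1)])
qed

lemma p_integral_mult:
  assumes "prime p" and "p_integral p x" and "p_integral p y"
  shows "p_integral p (x * y)"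
proof -
  obtain a b where b: "\<not> int p dvd b" "x = of_int a / of_int b"
    using p_integralE[OF assms(1,2)] .
  obtain c d where d: "\<not> int p dvd d" "y = of_int c / of_int d"
    using p_integralE[OF assms(1,3)] .
  have eq: "x * y = of_int (a * c) / of_int (b * d)"
    unfolding b(2) d(2) by simp
  have "\<not> int p dvd b * d"
    using assms(1) b(1) d(1) by (simp add: prime_dvd_mult_iff)
  then show ?thesis
    unfolding eq by (rule p_integralI[OF assms(1)])
qed

lemma p_integral_sum:
  assumes "prime p" and "\<And>i. i \<in> I \<Longrightarrow> p_integral p (x i)"
  shows "p_integral p (sum x I)"
  using assms(2) by (induction I rule: infinite_finite_induct) (auto intro: p_integral_add[OF assms(1)])

lemma p_integral_prod:
  assumes "prime p" and "\<And>i. i \<in> I \<Longrightarrow> p_integral p (x i)"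
  shows "p_integral p (prod x I)"
  using assms(2) by (induction I rule: infinite_finite_induct) (auto intro: p_integral_mult[OF assms(1)])

lemma p_integral_pochhammer:
  assumes "prime p" and "p_integral p x"
  shows "p_integral p (pochhammer x n)"
  unfolding pochhammer_prod
  by (intro p_integral_prod p_integral_add assms p_integral_of_nat)

section \<open>Reduction modulo p as a ring homomorphism\<close>

lemma red_rat_of_int [simp]: "red_rat (of_int a) = of_int a"
  by (simp add: red_rat_def)

lemma red_rat_of_nat [simp]: "red_rat (of_nat a) = of_nat a"
  by (simp add: red_rat_def)

lemma red_rat_0 [simp]: "red_rat 0 = 0" and red_rat_1 [simp]: "red_rat 1 = 1"
  using red_rat_of_nat[of 0] red_rat_of_nat[of 1] by simp_all

text \<open>The denominator in lowest terms divides b, so it stays nonzero in the field, where the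
  cross-multiplied integer identity can be divided out.\<close>

lemma red_rat_divide:
  assumes "of_int b \<noteq> (0 :: 'a::field)"
  shows "red_rat (of_int a / of_int b) = (of_int a / of_int b :: 'a)"
proof -
  obtain u v where uv: "quotient_of (of_int a / of_int b) = (u, v)"
    by fastforce
  have b: "b \<noteq> 0" using assms by auto
  obtain w where "b = v * w" using quotient_of_divide_dvd[OF uv b] ..
  with assms have "of_int v \<noteq> (0 :: 'a)" by auto
  moreover have "of_int a * of_int v = (of_int u * of_int b :: 'a)"
    using arg_cong[OF quotient_of_divide_cross_mult[OF uv b], of "of_int :: int \<Rightarrow> 'a"] by simp
  ultimately show ?thesis
    using assms by (simp add: red_rat_def uv field_simps)
qed

lemma p_integral_CHAR_E:
  assumes "p = CHAR('a::field)" and "prime p" and "p_integral p q"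
  obtains a b where "of_int b \<noteq> (0 :: 'a)" and "b \<noteq> 0" and "q = of_int a / of_int b"
    and "red_rat q = (of_int a / of_int b :: 'a)"
proof -
  obtain a b where ab: "\<not> int p dvd b" "q = of_int a / of_int b"
    using p_integralE[OF assms(2,3)] .
  then have "of_int b \<noteq> (0 :: 'a)"
    by (simp add: of_int_eq_0_iff_char_dvd assms(1))
  then show ?thesis using that ab(2) red_rat_divide by force
qed

lemma red_rat_add:
  assumes "p = CHAR('a::field)" and "prime p" and "p_integral p x" and "p_integral p y"
  shows "red_rat (x + y) = (red_rat x + red_rat y :: 'a)"
proof -
  obtain a b where b: "of_int b \<noteq> (0 :: 'a)" "b \<noteq> 0" "x = of_int a / of_int b"
    "red_rat x = (of_int a / of_int b :: 'a)"
    using p_integral_CHAR_E[OF assms(1,2,3)] .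
  obtain c d where d: "of_int d \<noteq> (0 :: 'a)" "d \<noteq> 0" "y = of_int c / of_int d"
    "red_rat y = (of_int c / of_int d :: 'a)"
    using p_integral_CHAR_E[OF assms(1,2,4)] .
  have "x + y = of_int (a * d + c * b) / of_int (b * d)"
    using b(2) d(2) by (simp add: b(3) d(3) add_frac_eq)
  moreover have "red_rat (of_int (a * d + c * b) / of_int (b * d)) =
      (of_int (a * d + c * b) / of_int (b * d) :: 'a)"
    using b(1) d(1) by (intro red_rat_divide) simp
  ultimately have "red_rat (x + y) = (of_int (a * d + c * b) / of_int (b * d) :: 'a)"
    by (simp only:)
  then show ?thesis using b(1) d(1) by (simp add: b(4) d(4) add_frac_eq)
qed

lemma red_rat_mult:
  assumes "p = CHAR('a::field)" and "prime p" and "p_integral p x" and "p_integral p y"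
  shows "red_rat (x * y) = (red_rat x * red_rat y :: 'a)"
proof -
  obtain a b where b: "of_int b \<noteq> (0 :: 'a)" "x = of_int a / of_int b"
    "red_rat x = (of_int a / of_int b :: 'a)"
    using p_integral_CHAR_E[OF assms(1,2,3)] .
  obtain c d where d: "of_int d \<noteq> (0 :: 'a)" "y = of_int c / of_int d"
    "red_rat y = (of_int c / of_int d :: 'a)"
    using p_integral_CHAR_E[OF assms(1,2,4)] .
  have "x * y = of_int (a * c) / of_int (b * d)"
    by (simp add: b(2) d(2))
  moreover have "red_rat (of_int (a * c) / of_int (b * d)) = (of_int (a * c) / of_int (b * d) :: 'a)"
    using b(1) d(1) by (intro red_rat_divide) simp
  ultimately have "red_rat (x * y) = (of_int (a * c) / of_int (b * d) :: 'a)"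
    by (simp only:)
  then show ?thesis by (simp add: b(3) d(3))
qed

lemma red_rat_prod:
  assumes "p = CHAR('a::field)" and "prime p" and "\<And>i. i \<in> I \<Longrightarrow> p_integral p (x i)"
  shows "red_rat (prod x I) = (\<Prod>i\<in>I. red_rat (x i) :: 'a)"
  using assms(3)
  by (induction I rule: infinite_finite_induct)
     (auto simp: red_rat_mult[OF assms(1,2)] p_integral_prod[OF assms(2)])

lemma red_rat_pochhammer:
  assumes "p = CHAR('a::field)" and "prime p" and "p_integral p x"
  shows "red_rat (pochhammer x n) = pochhammer (red_rat x :: 'a) n"
  unfolding pochhammer_prod
  by (subst red_rat_prod[OF assms(1,2)])
     (simp_all add: red_rat_add[OF assms(1,2,3)] p_integral_add[OF assms(2,3)])

text \<open>A nonzero residue of y means that its numerator is prime to p, so y is a unit among the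
  p-integral rationals and division is multiplication by its inverse.\<close>

lemma
  assumes "p = CHAR('a::field)" and "prime p" and "p_integral p x" and "p_integral p y"
    and nz: "red_rat y \<noteq> (0 :: 'a)"
  shows p_integral_divide: "p_integral p (x / y)"
    and red_rat_div: "red_rat (x / y) = (red_rat x / red_rat y :: 'a)"
proof -
  obtain a b where b: "of_int b \<noteq> (0 :: 'a)" "b \<noteq> 0" "y = of_int a / of_int b"
    "red_rat y = (of_int a / of_int b :: 'a)"
    using p_integral_CHAR_E[OF assms(1,2,4)] .
  have a: "of_int a \<noteq> (0 :: 'a)" using nz b(1,4) by auto
  then have pa: "\<not> int p dvd a" by (simp add: of_int_eq_0_iff_char_dvd assms(1))
  have eq: "x / y = x * (of_int b / of_int a)" by (simp add: b(3))
  show "p_integral p (x / y)"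
    unfolding eq by (intro p_integral_mult assms p_integralI pa)
  show "red_rat (x / y) = (red_rat x / red_rat y :: 'a)"
    unfolding eq using assms a b(1)
    by (subst red_rat_mult[OF assms(1-3) p_integralI[OF assms(2) pa]])
       (simp add: red_rat_divide b(4))
qed

lemma rat_cong_imp_red_rat_eq:
  assumes "p = CHAR('a::field)" and "prime p" and "rat_cong p x y"
  shows "red_rat x = (red_rat y :: 'a)"
proof -
  obtain t where t: "p_integral p y" "p_integral p t" "x = y + of_nat p * t"
    using assms(3) by (auto simp: rat_cong_def algebra_simps)
  have "red_rat x = (red_rat y + of_nat p * red_rat t :: 'a)"
    unfolding t(3) using t(1,2) assms(2)
    by (simp add: red_rat_add[OF assms(1,2)] red_rat_mult[OF assms(1,2)] p_integral_mult)
  then show ?thesis using assms(1) by simp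
qed

subsection \<open>The integer \<open>n'\<^sub>s\<close>\<close>

text \<open>\<open>n_prime\<close> is a definite description, so existence and uniqueness are both
  required: existence comes from Bezout, uniqueness from reading the equation modulo p.\<close>

lemma n_prime_spec:
  assumes "coprime p N" and "p > 0" and "1 \<le> s" and "s \<le> N - 1"
  shows "n_prime p N s < p" and
    "\<exists>m. 1 \<le> m \<and> m \<le> N - 1 \<and> int m * int p - int (n_prime p N s) * int N = int s"
proof -
  let ?P = "\<lambda>n. n < p \<and>
     (\<exists>m. 1 \<le> m \<and> m \<le> N - 1 \<and> int m * int p - int n * int N = int s)"
  have N: "N > 1" using assms by auto
  obtain u v where uv: "u * int p + v * int N = 1"
    using bezout_int[of "int p" "int N"] assms(1) by (auto simp: coprime_iff_gcd_eq_1)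
  \<comment> \<open>Since u p \<equiv> 1 modulo N, the residue of u s solves m p \<equiv> s modulo
    N.\<close>
  define m where "m = nat ((u * int s) mod int N)"
  have int_m: "int m = (u * int s) mod int N" and m: "m < N"
    using N by (simp_all add: m_def nat_less_iff)
  have "s < N" using assms(4) N by simp
  have "int m * int p - int s = int N * (- (u * int s div int N) * int p - v * int s)"
  proof -
    have m_eq: "int m = u * int s - int N * (u * int s div int N)"
      unfolding int_m by (simp add: minus_mult_div_eq_mod)
    have "int m * int p = u * int p * int s - int N * (u * int s div int N) * int p"
      unfolding m_eq by (simp add: algebra_simps)
    moreover have "int s = u * int p * int s + v * int N * int s"
      using arg_cong[OF uv, of "\<lambda>x. x * int s"] by (simp add: algebra_simps)
    ultimately show ?thesis by (simp add: algebra_simps)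
  qed
  then obtain n where n: "int m * int p - int s = int N * n" by blast
  have "m \<noteq> 0"
  proof
    assume "m = 0"
    then have "int N dvd int s" using n by (metis dvd_triv_left diff_0 dvd_minus_iff mult_zero_left of_nat_0)
    then show False using \<open>s < N\<close> assms(3) by (auto dest: dvd_imp_le)
  qed
  \<comment> \<open>A negative n would give m p \<le> s - N < 0.\<close>
  have "n \<ge> 0"
  proof (rule ccontr)
    assume "\<not> n \<ge> 0"
    then have "int N * n \<le> int N * (-1)" using N by (intro mult_left_mono) auto
    then show False using n \<open>s < N\<close> mult_nonneg_nonneg[of "int m" "int p"] by linarith
  qed
  have "int N * n < int N * int p"
  proof -
    have "int m * int p < int N * int p" using m assms(2) by simp
    then show ?thesis using n by linarith
  qed
  then have np: "nat n < p" using \<open>n \<ge> 0\<close> N by auto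
  have ex: "?P (nat n)"
  proof (intro conjI exI)
    show "int m * int p - int (nat n) * int N = int s"
      using n \<open>n \<ge> 0\<close> by (simp add: algebra_simps)
  qed (use np m \<open>m \<noteq> 0\<close> in auto)
  have unique: "n1 = n2" if 1: "?P n1" and 2: "?P n2" for n1 n2
  proof -
    obtain m1 where m1: "int m1 * int p - int n1 * int N = int s" using 1 by blast
    obtain m2 where m2: "int m2 * int p - int n2 * int N = int s" using 2 by blast
    have "(int m1 - int m2) * int p = (int n1 - int n2) * int N"
      using m1 m2 by (simp add: algebra_simps)
    then have "int p dvd (int n1 - int n2) * int N" by (metis dvd_triv_right)
    then have "int p dvd int n1 - int n2"
      using assms(1) by (simp add: coprime_dvd_mult_left_iff)
    then have "int n1 mod int p = int n2 mod int p" by (simp add: mod_eq_dvd_iff)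
    then show ?thesis using 1 2 by simp
  qed
  have "?P (n_prime p N s)"
    unfolding n_prime_def by (rule theI[of ?P, OF ex unique[OF _ ex]])
  then show "n_prime p N s < p"
    "\<exists>m. 1 \<le> m \<and> m \<le> N - 1 \<and> int m * int p - int (n_prime p N s) * int N = int s"
    by blast+
qed

subsection \<open>Evaluation of multivariate polynomials\<close>

text \<open>Isolates the monomial factor of \<open>msubst\<close>, which is multiplicative in the
  exponent vector.\<close>

definition mono_eval :: "(nat \<Rightarrow> 'a::comm_semiring_1) \<Rightarrow> (nat \<Rightarrow>\<^sub>0 nat) \<Rightarrow> 'a" where
  "mono_eval v e = (\<Prod>k\<in>Poly_Mapping.keys e. v k ^ Poly_Mapping.lookup e k)"

text \<open>Indices outside the support contribute \<open>v k ^ 0 = 1\<close>, so monomials with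
  different supports can be compared over one index set.\<close>

lemma mono_eval_superset:
  assumes "finite K" and "Poly_Mapping.keys e \<subseteq> K"
  shows "mono_eval v e = (\<Prod>k\<in>K. v k ^ Poly_Mapping.lookup e k)"
  unfolding mono_eval_def
  by (rule prod.mono_neutral_left[OF assms]) (auto simp: in_keys_iff)

lemma mono_eval_0 [simp]: "mono_eval v 0 = 1"
  by (simp add: mono_eval_def)

lemma mono_eval_single [simp]: "mono_eval v (Poly_Mapping.single k n) = v k ^ n"
  by (subst mono_eval_superset[of "{k}"]) auto

lemma mono_eval_add: "mono_eval v (d + e) = mono_eval v d * mono_eval v e"
proof -
  let ?K = "Poly_Mapping.keys d \<union> Poly_Mapping.keys e"
  have "mono_eval v x = (\<Prod>k\<in>?K. v k ^ Poly_Mapping.lookup x k)"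
    if "x \<in> {d, e, d + e}" for x
    using that Poly_Mapping.keys_add[of d e] by (intro mono_eval_superset) auto
  then show ?thesis
    by (simp add: lookup_add power_add prod.distrib)
qed

lemma msubst_superset:
  assumes "h 0 = 0" and "finite S" and "Poly_Mapping.keys P \<subseteq> S"
  shows "msubst h v P = (\<Sum>e\<in>S. h (Poly_Mapping.lookup P e) * mono_eval v e)"
  unfolding msubst_def mono_eval_def
  by (rule sum.mono_neutral_left[OF assms(2,3)]) (auto simp: in_keys_iff assms(1))

lemma msubst_single:
  assumes "h 0 = 0"
  shows "msubst h v (Poly_Mapping.single e c) = h c * mono_eval v e"
  by (subst msubst_superset[of _ "{e}"]) (insert assms, auto)

text \<open>Additivity of h is demanded only at the coefficients that occur, because
  \<open>red_rat\<close> is additive on p-integral rationals but not on all rationals.\<close>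

lemma msubst_add:
  assumes "h 0 = 0"
    and "\<And>e. h (Poly_Mapping.lookup P e + Poly_Mapping.lookup Q e) =
      h (Poly_Mapping.lookup P e) + h (Poly_Mapping.lookup Q e)"
  shows "msubst h v (P + Q) = msubst h v P + msubst h v Q"
proof -
  let ?K = "Poly_Mapping.keys P \<union> Poly_Mapping.keys Q"
  have "msubst h v Y = (\<Sum>e\<in>?K. h (Poly_Mapping.lookup Y e) * mono_eval v e)"
    if "Y \<in> {P, Q, P + Q}" for Y
    using that Poly_Mapping.keys_add[of P Q] by (intro msubst_superset assms(1)) auto
  then show ?thesis
    by (simp add: lookup_add assms(2) sum.distrib distrib_right)
qed

lemma msubst_mconst_sum_single:
  "msubst mconst v (\<Sum>i\<in>I. Poly_Mapping.single (m i) (c i)) =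
     (\<Sum>i\<in>I. mconst (c i) * mono_eval v (m i))"
proof (induction I rule: infinite_finite_induct)
  case (insert i I)
  then show ?case
    by (simp add: msubst_add msubst_single mconst_def single_add)
qed (simp_all add: msubst_def)

text \<open>The exponents \<open>m i\<close> may coincide, so a coefficient is in general a sum of
  several \<open>c i\<close>.\<close>

lemma p_integral_lookup_sum_single:
  assumes "prime p" and "\<And>i. i \<in> I \<Longrightarrow> p_integral p (c i)"
  shows "p_integral p (Poly_Mapping.lookup (\<Sum>i\<in>I. Poly_Mapping.single (m i) (c i)) e)"
  unfolding lookup_sum
  by (rule p_integral_sum[OF assms(1)]) (simp add: lookup_single when_def assms(2))

lemma msubst_red_rat_sum_single:
  fixes v :: "nat \<Rightarrow> 'a::field"
  assumes "p = CHAR('a)" and "prime p" and "\<And>i. i \<in> I \<Longrightarrow> p_integral p (c i)"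
  shows "msubst red_rat v (\<Sum>i\<in>I. Poly_Mapping.single (m i) (c i)) =
     (\<Sum>i\<in>I. red_rat (c i) * mono_eval v (m i))"
  using assms(3)
proof (induction I rule: infinite_finite_induct)
  case (insert i I)
  have "msubst red_rat v (Poly_Mapping.single (m i) (c i) + (\<Sum>i\<in>I. Poly_Mapping.single (m i) (c i)))
      = msubst red_rat v (Poly_Mapping.single (m i) (c i)) +
        msubst red_rat v (\<Sum>i\<in>I. Poly_Mapping.single (m i) (c i))"
    by (intro msubst_add red_rat_add[OF assms(1,2)] p_integral_lookup_sum_single assms(2))
       (auto simp: lookup_single when_def insert.prems)
  then show ?case
    using insert by (simp add: msubst_single)
qed (simp_all add: msubst_def)

subsection \<open>Products of powers of linear polynomials\<close>

text \<open>Reversing the coefficients removes the factor \<open>x ^ A\<^sub>0\<close> and turns each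
  \<open>x - z\<close> into \<open>1 - z x\<close>.\<close>

lemma reflect_poly_linear [simp]: "reflect_poly [:- z, 1:] = [:1, - z :: 'a::field:]"
  by (cases "z = 0") (simp_all add: reflect_poly_pCons pCons_one reflect_poly_pCons')

text \<open>This is the coefficient of x^i in (1 - x)^n and also the integer (-n; i) / i!. The first
  reading serves the powers of f, the second the hypergeometric coefficients.\<close>

definition neg_binom :: "nat \<Rightarrow> nat \<Rightarrow> 'a::comm_ring_1" where
  "neg_binom n i = (-1) ^ i * of_nat (n choose i)"

lemma linear_power_eq_sum_monom:
  "[:1, - z :: 'a::comm_ring_1:] ^ n = (\<Sum>i\<le>n. monom (neg_binom n i * z ^ i) i)"
proof -
  have "[:1, - z:] = monom (- z) 1 + 1"
    by (simp add: monom_altdef one_pCons)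
  then have "[:1, - z:] ^ n = (\<Sum>i\<le>n. of_nat (n choose i) * monom (- z) 1 ^ i)"
    by (simp add: binomial_ring)
  also have "\<dots> = (\<Sum>i\<le>n. monom (neg_binom n i * z ^ i) i)"
    by (intro sum.cong)
       (simp_all add: monom_power neg_binom_def of_nat_poly smult_monom power_minus[of z] mult_ac)
  finally show ?thesis .
qed

lemma prod_monom: "(\<Prod>i\<in>I. monom (c i) (e i)) = monom (\<Prod>i\<in>I. c i) (\<Sum>i\<in>I. e i)"
  by (induction I rule: infinite_finite_induct) (simp_all add: mult_monom)

text \<open>The exponent d - S must be supplied by (1 - x)^n, so it lies between 0 and n. These are
  the bounds that the truncation puts on the total exponent S.\<close>

lemma coeff_monom_mult_linear_power:
  "Polynomial.coeff (monom (c :: 'a::comm_ring_1) S * [:1, -1:] ^ n) d =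
    (if S \<le> d \<and> d \<le> n + S then c * neg_binom n (d - S) else 0)"
proof -
  have "Polynomial.coeff ([:1, -1 :: 'a:] ^ n) i = (if i \<le> n then neg_binom n i else 0)" for i
    unfolding linear_power_eq_sum_monom by (simp add: coeff_sum)
  then show ?thesis
    by (auto simp: coeff_monom_mult)
qed

text \<open>Distributivity turns the product of sums into a sum over functions g choosing one
  exponent per factor. The factor (1 - x)^n is kept apart, as its exponent is determined by
  g.\<close>

lemma coeff_prod_linear_power:
  fixes z :: "nat \<Rightarrow> 'a::comm_ring_1"
  assumes "finite I"
  shows "Polynomial.coeff ([:1, -1:] ^ n * (\<Prod>i\<in>I. [:1, - z i:] ^ n)) d =
    (\<Sum>g | g \<in> I \<rightarrow>\<^sub>E {..n} \<and> sum g I \<le> d \<and> d \<le> n + sum g I.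
       neg_binom n (d - sum g I) * (\<Prod>i\<in>I. neg_binom n (g i) * z i ^ g i))"
proof -
  have fin: "finite (I \<rightarrow>\<^sub>E {..n})" using assms by (intro finite_PiE) auto
  have "(\<Prod>i\<in>I. [:1, - z i:] ^ n) =
      (\<Sum>g\<in>I \<rightarrow>\<^sub>E {..n}. monom (\<Prod>i\<in>I. neg_binom n (g i) * z i ^ g i) (sum g I))"
    unfolding linear_power_eq_sum_monom
    by (subst prod_sum_PiE) (simp_all add: assms prod_monom)
  then have "Polynomial.coeff ([:1, -1:] ^ n * (\<Prod>i\<in>I. [:1, - z i:] ^ n)) d =
    (\<Sum>g\<in>I \<rightarrow>\<^sub>E {..n}. if sum g I \<le> d \<and> d \<le> n + sum g I then
       (\<Prod>i\<in>I. neg_binom n (g i) * z i ^ g i) * neg_binom n (d - sum g I) else 0)"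
    by (simp add: sum_distrib_left coeff_sum coeff_monom_mult_linear_power mult.commute[of "_ ^ n"])
  also have "\<dots> = (\<Sum>g\<in>{g\<in>I \<rightarrow>\<^sub>E {..n}. sum g I \<le> d \<and> d \<le> n + sum g I}.
       neg_binom n (d - sum g I) * (\<Prod>i\<in>I. neg_binom n (g i) * z i ^ g i))"
    by (subst sum.inter_filter[OF fin]) (auto intro!: sum.cong simp: mult.commute)
  finally show ?thesis by simp
qed

subsection \<open>Coefficients of the truncated series modulo \<open>p\<close>\<close>

text \<open>For i \<le> n this is (-1)^i n! / (n - i)!; for i > n a factor 0 occurs on both
  sides.\<close>

lemma pochhammer_minus_of_nat:
  "pochhammer (- of_nat n :: 'a::idom) i = neg_binom n i * of_nat (fact i)"
proof (cases "i \<le> n")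
  case True
  \<comment> \<open>The identity is proved in the naturals, where (n - i)! can be cancelled; in
    positive characteristic it may vanish.\<close>
  have "fact (n - i) * pochhammer (n - i + 1) i = (fact n :: nat)"
    using pochhammer_product[of "n - i" n "1::nat"] True
    by (simp add: pochhammer_fact add.commute)
  also have "\<dots> = fact (n - i) * (fact i * (n choose i))"
    using binomial_fact_lemma[OF True] by (simp add: mult_ac)
  finally have "pochhammer (n - i + 1) i = fact i * (n choose i)"
    by simp
  then have "pochhammer (of_nat (n - i + 1)) i = (of_nat (fact i * (n choose i)) :: 'a)"
    by (simp only: pochhammer_of_nat)
  moreover have "of_nat n - of_nat i + 1 = (of_nat (n - i + 1) :: 'a)"
    using True by (simp add: of_nat_diff)
  ultimately show ?thesis
    by (simp only: pochhammer_minus neg_binom_def of_nat_mult mult_ac)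
next
  case False
  then show ?thesis by (simp add: pochhammer_of_nat_eq_0_lemma neg_binom_def binomial_eq_0)
qed

lemma of_nat_fact_nonzero:
  assumes "prime CHAR('a::field)" and "i < CHAR('a)"
  shows "of_nat (fact i) \<noteq> (0 :: 'a)"
  using assms by (simp add: of_nat_eq_0_iff_char_dvd prime_dvd_fact_iff del: of_nat_fact)

text \<open>The quotient \<open>(c; d) (a; S) / ((a; d) (c; S))\<close> plays the role of the missing first
  variable: after cancellation it is \<open>(c + S; d - S) / (a + S; d - S)\<close>, which is
  \<open>p\<close>-integral although \<open>(a; d)\<close> itself may be divisible by \<open>p\<close>.\<close>

lemma red_rat_AL_coeff:
  fixes e :: "'i \<Rightarrow> nat"
  assumes p: "p = CHAR('a::field)" "prime p" and n: "n < p"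
    and b: "p_integral p b" "red_rat b = (- of_nat n :: 'a)"
    and a: "p_integral p a" "red_rat a = (- of_nat d :: 'a)"
    and c: "c = a + 1 - b" and pos: "a > 0" "c > 0"
    and S: "S \<le> d" "d \<le> n + S" and e: "\<And>k. k \<in> I \<Longrightarrow> e k \<le> n"
  defines "C \<equiv> pochhammer c d / pochhammer a d *
     ((pochhammer a S * (\<Prod>k\<in>I. pochhammer b (e k))) /
      (pochhammer c S * (\<Prod>k\<in>I. pochhammer 1 (e k))))"
  shows "p_integral p C"
    and "red_rat C = (neg_binom n (d - S) * (\<Prod>k\<in>I. neg_binom n (e k)) :: 'a)"
proof -
  \<comment> \<open>The eliminated exponent e_1 of the variable z_1 = 1.\<close>
  define i where "i = d - S"
  have i: "i \<le> n" "d = i + S" using S by (auto simp: i_def)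
  have fact_nz: "of_nat (fact k) \<noteq> (0 :: 'a)" if "k \<le> n" for k
    using of_nat_fact_nonzero[of k, where 'a = 'a] p n that by simp
  \<comment> \<open>Positivity of a and c is what allows (a; S) and (c; S) to be cancelled over the
    rationals.\<close>
  have "pochhammer c S \<noteq> 0" "pochhammer a S \<noteq> 0"
    using pos pochhammer_pos[of c S] pochhammer_pos[of a S] by auto
  then have C: "C = pochhammer (c + of_nat S) i / pochhammer (a + of_nat S) i *
     (\<Prod>k\<in>I. pochhammer b (e k) / pochhammer 1 (e k))"
    unfolding C_def using pochhammer_product[OF S(1), of c] pochhammer_product[OF S(1), of a]
    by (simp add: i_def prod_dividef)
  have cS: "p_integral p (c + of_nat S)"
  proof -
    have "c + of_nat S = a + (of_nat (S + 1) + of_int (-1) * b)"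
      by (simp add: c)
    then show ?thesis
      by (simp only: p_integral_add[OF p(2)] p_integral_mult[OF p(2)] a b p_integral_of_nat p_integral_of_int)
  qed
  \<comment> \<open>With residues -d of a and -n of b, and d = i + S, the sum a + 1 - b + S reduces
    to n - i + 1.\<close>
  have red_cS: "red_rat (c + of_nat S) = (of_nat n - of_nat i + 1 :: 'a)"
  proof -
    have "c + of_nat S = a + (of_nat (S + 1) + of_int (-1) * b)"
      by (simp add: c)
    then have "red_rat (c + of_nat S) = (red_rat a + (of_nat (S + 1) + of_int (-1) * red_rat b) :: 'a)"
      by (simp only: red_rat_add[OF p] red_rat_mult[OF p] p_integral_add[OF p(2)]
          p_integral_mult[OF p(2)] a b p_integral_of_nat p_integral_of_int
          red_rat_of_nat red_rat_of_int)
    then show ?thesis by (simp add: a b i(2))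
  qed
  have aS: "p_integral p (a + of_nat S)" "red_rat (a + of_nat S) = (- of_nat i :: 'a)"
    using a by (simp_all add: p_integral_add[OF p(2)] red_rat_add[OF p] i(2))
  have den: "red_rat (pochhammer (a + of_nat S) i) = ((-1) ^ i * of_nat (fact i) :: 'a)"
    by (simp only: red_rat_pochhammer[OF p] aS pochhammer_minus_of_nat)
       (simp add: neg_binom_def)
  have num: "red_rat (pochhammer (c + of_nat S) i) =
      ((-1) ^ i * (neg_binom n i * of_nat (fact i)) :: 'a)"
    \<comment> \<open>This rewrites (n - i + 1; i) as (-1)^i (-n; i).\<close>
    using pochhammer_minus[of "of_nat n :: 'a" i]
    by (simp add: red_rat_pochhammer[OF p cS] red_cS pochhammer_minus_of_nat)
  note int1 = p_integral_pochhammer[OF p(2) cS, of i] p_integral_pochhammer[OF p(2) aS(1), of i]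
  \<comment> \<open>The residue is that of (-i; i) = (-1)^i i!, a unit because i \<le> n <
    p.\<close>
  have nz1: "red_rat (pochhammer (a + of_nat S) i) \<noteq> (0 :: 'a)"
    using fact_nz[OF i(1)] by (simp add: den)
  have quot1: "p_integral p (pochhammer (c + of_nat S) i / pochhammer (a + of_nat S) i)"
    "red_rat (pochhammer (c + of_nat S) i / pochhammer (a + of_nat S) i) = (neg_binom n i :: 'a)"
    using fact_nz[OF i(1)]
    by (simp_all add: p_integral_divide[OF p int1 nz1] red_rat_div[OF p int1 nz1] num den)
  have quot2: "p_integral p (pochhammer b m / pochhammer 1 m)"
    "red_rat (pochhammer b m / pochhammer 1 m) = (neg_binom n m :: 'a)" if "m \<le> n" for m
  proof -
    have one: "pochhammer 1 m = (of_nat (fact m) :: rat)"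
      using pochhammer_of_nat[of 1 m, where 'a = rat] by (simp add: pochhammer_fact)
    have nz: "red_rat (pochhammer 1 m) \<noteq> (0 :: 'a)"
      unfolding one red_rat_of_nat by (rule fact_nz[OF that])
    have int: "p_integral p (pochhammer b m)" "p_integral p (pochhammer 1 m)"
      using p_integral_pochhammer[OF p(2)] b by simp_all
    show "p_integral p (pochhammer b m / pochhammer 1 m)"
      by (rule p_integral_divide[OF p int nz])
    show "red_rat (pochhammer b m / pochhammer 1 m) = (neg_binom n m :: 'a)"
      unfolding red_rat_div[OF p int nz] red_rat_pochhammer[OF p b(1)] b(2)
        pochhammer_minus_of_nat
      unfolding one red_rat_of_nat using fact_nz[OF that] by simp
  qed
  have int2: "p_integral p (\<Prod>k\<in>I. pochhammer b (e k) / pochhammer 1 (e k))"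
    by (intro p_integral_prod p(2) quot2 e)
  show "p_integral p C"
    unfolding C by (intro p_integral_mult p(2) quot1 int2)
  have "red_rat C = (neg_binom n i * (\<Prod>k\<in>I. red_rat (pochhammer b (e k) / pochhammer 1 (e k))) :: 'a)"
    unfolding C by (simp only: red_rat_mult[OF p quot1(1) int2] quot1(2) red_rat_prod[OF p quot2(1)[OF e]])
  also have "\<dots> = neg_binom n i * (\<Prod>k\<in>I. neg_binom n (e k))"
    by (intro arg_cong2[where f = "(*)"] prod.cong refl quot2(2) e)
  finally show "red_rat C = (neg_binom n (d - S) * (\<Prod>k\<in>I. neg_binom n (e k)) :: 'a)"
    unfolding i_def .
qed

subsection \<open>The coefficients of \<open>f ^ n'\<^sub>s\<close>\<close>

lemma to_ac_coeff_power:
  "to_ac (Polynomial.coeff (f ^ n) i) = Polynomial.coeff (map_poly to_ac f ^ n) i"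
  by (induction n arbitrary: i) (auto simp: coeff_mult coeff_map_poly to_ac_sum)

lemma degree_map_poly_to_ac [simp]: "Polynomial.degree (map_poly to_ac f) = Polynomial.degree f"
  by (rule degree_map_poly) simp_all

text \<open>Multiplication of exponent vectors is convolution, so \<open>of_nat n * m\<close>
  is the \<open>n\<close>-fold multiple of \<open>m\<close>.\<close>

lemma single_power:
  fixes m :: "nat \<Rightarrow>\<^sub>0 nat"
  shows "Poly_Mapping.single m (1 :: 'a::comm_semiring_1) ^ n = Poly_Mapping.single (of_nat n * m) 1"
  by (induction n) (simp_all add: mult_single distrib_right)

lemma prod_single:
  "(\<Prod>i\<in>I. Poly_Mapping.single (m i) (1 :: 'a::comm_semiring_1)) =
     Poly_Mapping.single (\<Sum>i\<in>I. m i) 1"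
  by (induction I rule: infinite_finite_induct) (simp_all add: mult_single)

lemma mono_eval_sum: "mono_eval v (\<Sum>i\<in>I. m i) = (\<Prod>i\<in>I. mono_eval v (m i))"
  by (induction I rule: infinite_finite_induct) (simp_all add: mono_eval_add)

lemma mono_eval_of_nat_mult: "mono_eval v (of_nat n * m) = mono_eval v m ^ n"
  by (induction n) (simp_all add: mono_eval_add distrib_right)

text \<open>Every specialized argument is a monomial, encoded here by its exponent vector: 0 for the
  value 1, a unit vector for an indeterminate. One list thus serves both the formal substitution and
  the evaluation at \<open>lam\<close>.\<close>

definition AL_exps :: "(nat \<Rightarrow> nat) \<Rightarrow> nat \<Rightarrow> (nat \<Rightarrow>\<^sub>0 nat) list" where
  "AL_exps A r = replicate (A 1 - 1) 0 @
     concat (map (\<lambda>k. replicate (A k) (Poly_Mapping.single k 1)) [2..<r + 1])"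

lemma AL_args_eq: "AL_args A r = map (\<lambda>e. Poly_Mapping.single e 1) (AL_exps A r)"
  by (simp add: AL_args_def AL_exps_def map_concat comp_def mvar_def)

lemma prod_list_AL_exps:
  fixes G :: "(nat \<Rightarrow>\<^sub>0 nat) \<Rightarrow> 'a::comm_monoid_mult"
  shows "(\<Prod>e\<leftarrow>AL_exps A r. G e) = G 0 ^ (A 1 - 1) * (\<Prod>k=2..r. G (Poly_Mapping.single k 1) ^ A k)"
proof -
  have "(\<Prod>e\<leftarrow>concat (map (\<lambda>k. replicate (A k) (Poly_Mapping.single k 1)) ks). G e) =
      (\<Prod>k\<leftarrow>ks. G (Poly_Mapping.single k 1) ^ A k)" for ks
    by (induction ks) (simp_all add: prod_list_replicate)
  moreover have "(\<Prod>k\<leftarrow>[2..<r + 1]. G (Poly_Mapping.single k 1) ^ A k) =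
      (\<Prod>k=2..r. G (Poly_Mapping.single k 1) ^ A k)"
    by (simp add: prod.distinct_set_conv_list[symmetric] atLeastLessThanSuc_atLeastAtMost
        del: upt_Suc)
  ultimately show ?thesis
    by (simp add: AL_exps_def prod_list_replicate del: upt_Suc)
qed

lemma length_AL_exps: "length (AL_exps A r) = (A 1 - 1) + (\<Sum>k=2..r. A k)"
proof -
  have "(\<Sum>k\<leftarrow>[2..<r + 1]. A k) = (\<Sum>k=2..r. A k)"
    by (simp add: sum.distinct_set_conv_list[symmetric] atLeastLessThanSuc_atLeastAtMost
        del: upt_Suc)
  then show ?thesis
    by (simp add: AL_exps_def length_concat comp_def del: upt_Suc)
qed

text \<open>The variables are numbered from 2, the list entries from 0.\<close>

lemma prod_shifted_nth:
  "(\<Prod>i=2..length xs + 1. G (xs ! (i - 2))) = (\<Prod>x\<leftarrow>xs. G x :: 'a::comm_monoid_mult)"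
proof -
  have "(\<Prod>i=2..length xs + 1. G (xs ! (i - 2))) = (\<Prod>i<length xs. G (xs ! i))"
    by (rule prod.reindex_bij_witness[of _ "\<lambda>i. i + 2" "\<lambda>i. i - 2"]) auto
  then show ?thesis
    by (simp add: prod.list_conv_set_nth atLeast0LessThan)
qed

text \<open>The power of x reflects to 1. One factor x - 1 is split off for z_1 = 1; the remaining
  A_1 - 1 match the leading zeros of \<open>AL_exps\<close>.\<close>

lemma reflect_poly_product_linear_power:
  fixes lam :: "nat \<Rightarrow> 'a::field"
  assumes "A 1 \<ge> 1" and "r \<ge> 1" and R: "R = (\<Sum>k=1..r. A k)"
  shows "reflect_poly (([:0, 1:] ^ m * [:-1, 1:] ^ A 1 * (\<Prod>k=2..r. [:- lam k, 1:] ^ A k)) ^ n) =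
     [:1, -1:] ^ n * (\<Prod>i=2..R. [:1, - mono_eval lam (AL_exps A r ! (i - 2)):] ^ n)"
proof -
  have R': "R = length (AL_exps A r) + 1"
    using assms(1,2) by (simp add: R length_AL_exps sum.atLeast_Suc_atMost numeral_2_eq_2)
  have "(\<Prod>i=2..R. [:1, - mono_eval lam (AL_exps A r ! (i - 2)):] ^ n) =
     ([:1, -1:] ^ (A 1 - 1) * (\<Prod>k=2..r. [:1, - lam k:] ^ A k)) ^ n"
    unfolding R' prod_power_distrib[symmetric]
    by (subst prod_shifted_nth[of "\<lambda>e. [:1, - mono_eval lam e:]"]) (simp add: prod_list_AL_exps)
  moreover have "[:1, -1 :: 'a:] ^ A 1 = [:1, -1:] * [:1, -1:] ^ (A 1 - 1)"
    using assms(1) by (metis Suc_diff_1 less_eq_Suc_le One_nat_def power_Suc)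
  moreover have "reflect_poly [:0, 1 :: 'a:] = 1" "reflect_poly [:-1, 1 :: 'a:] = [:1, -1:]"
    using reflect_poly_linear[of "0 :: 'a"] reflect_poly_linear[of "1 :: 'a"]
    by (simp_all add: one_pCons)
  ultimately show ?thesis
    by (simp add: reflect_poly_power reflect_poly_mult reflect_poly_prod power_mult_distrib mult_ac
        del: mult_pCons_left mult_pCons_right)
qed

text \<open>The bijection restricts to {2..R} one way and extends by 0 the other. Outside {2..R} the
  two encodings take different default values, hence the premise on F. Writing d \<le> n + S avoids
  truncated subtraction.\<close>

lemma sum_AL_trunc_exps:
  fixes F :: "(nat \<Rightarrow> nat) \<Rightarrow> 'a::comm_monoid_add"
  assumes "\<And>g h. (\<And>k. k \<in> {2..R} \<Longrightarrow> g k = h k) \<Longrightarrow> F g = F h"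
  shows "(\<Sum>e\<in>AL_trunc_exps R (int d) (\<lambda>_. int n). F (Poly_Mapping.lookup e)) =
    (\<Sum>g | g \<in> {2..R} \<rightarrow>\<^sub>E {..n} \<and> sum g {2..R} \<le> d \<and> d \<le> n + sum g {2..R}. F g)"
proof -
  have lookup_Abs: "Poly_Mapping.lookup (Abs_poly_mapping (\<lambda>k. if k \<in> {2..R} then g k else 0)) =
      (\<lambda>k. if k \<in> {2..R} then g k else 0)" for g :: "nat \<Rightarrow> nat"
    by (rule lookup_Abs_poly_mapping) (rule finite_subset[of _ "{2..R}"], auto split: if_splits)
  have keys_sub: "Poly_Mapping.lookup e k = 0" if "Poly_Mapping.keys e \<subseteq> {2..R}" "k \<notin> {2..R}" for e k
    using that by (auto simp: in_keys_iff)
  show ?thesis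
  proof (rule sum.reindex_bij_witness[of _
        "\<lambda>g. Abs_poly_mapping (\<lambda>k. if k \<in> {2..R} then g k else 0)"
        "\<lambda>e. restrict (Poly_Mapping.lookup e) {2..R}"])
    fix e assume e: "e \<in> AL_trunc_exps R (int d) (\<lambda>_. int n)"
    then have keys: "Poly_Mapping.keys e \<subseteq> {2..R}" by (simp add: AL_trunc_exps_def)
    show "Abs_poly_mapping (\<lambda>k. if k \<in> {2..R} then restrict (Poly_Mapping.lookup e) {2..R} k else 0) = e"
      by (rule poly_mapping_eqI, subst lookup_Abs) (simp add: keys_sub[OF keys] del: atLeastAtMost_iff)
    have "sum (restrict (Poly_Mapping.lookup e) {2..R}) {2..R} = sum (Poly_Mapping.lookup e) {2..R}"
      by (intro sum.cong) auto
    then show "restrict (Poly_Mapping.lookup e) {2..R} \<in>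
        {g. g \<in> {2..R} \<rightarrow>\<^sub>E {..n} \<and> sum g {2..R} \<le> d \<and> d \<le> n + sum g {2..R}}"
      using e by (auto simp: AL_trunc_exps_def simp del: of_nat_sum)
    show "F (restrict (Poly_Mapping.lookup e) {2..R}) = F (Poly_Mapping.lookup e)"
      by (rule assms) simp
  next
    fix g assume g: "g \<in> {g. g \<in> {2..R} \<rightarrow>\<^sub>E {..n} \<and> sum g {2..R} \<le> d \<and> d \<le> n + sum g {2..R}}"
    then show "restrict (Poly_Mapping.lookup
        (Abs_poly_mapping (\<lambda>k. if k \<in> {2..R} then g k else 0))) {2..R} = g"
      unfolding lookup_Abs by (auto simp: fun_eq_iff PiE_def extensional_def restrict_def)
    have "(\<Sum>k=2..R. if k \<in> {2..R} then g k else 0) = sum g {2..R}"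
      by (intro sum.cong) auto
    then show "Abs_poly_mapping (\<lambda>k. if k \<in> {2..R} then g k else 0) \<in>
        AL_trunc_exps R (int d) (\<lambda>_. int n)"
      using g unfolding AL_trunc_exps_def lookup_Abs mem_Collect_eq
      by (auto simp: in_keys_iff lookup_Abs PiE_iff simp del: of_nat_sum split: if_splits)
  qed
qed

text \<open>The arguments are monomials with coefficient 1, so each term of the series stays a
  single monomial and keeps its coefficient.\<close>

lemma msubst_mconst_AL_trunc:
  assumes "length (AL_exps A r) = R - 1"
  shows "mconst q * msubst mconst (\<lambda>k. AL_args A r ! (k - 2)) (AL_trunc R d \<tau> a b c) =
    (\<Sum>e\<in>AL_trunc_exps R d \<tau>. Poly_Mapping.single
       (\<Sum>k=2..R. of_nat (Poly_Mapping.lookup e k) * AL_exps A r ! (k - 2)) (q * AL_coeff R a b c e))"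
proof -
  have "mono_eval (\<lambda>k. AL_args A r ! (k - 2) :: rat mpol) e =
      Poly_Mapping.single (\<Sum>k=2..R. of_nat (Poly_Mapping.lookup e k) * AL_exps A r ! (k - 2)) 1"
    if "e \<in> AL_trunc_exps R d \<tau>" for e
  proof -
    have "Poly_Mapping.keys e \<subseteq> {2..R}" using that by (simp add: AL_trunc_exps_def)
    then have "mono_eval (\<lambda>k. AL_args A r ! (k - 2) :: rat mpol) e =
        (\<Prod>k=2..R. (AL_args A r ! (k - 2)) ^ Poly_Mapping.lookup e k)"
      by (intro mono_eval_superset) auto
    also have "\<dots> = (\<Prod>k=2..R. Poly_Mapping.single
        (of_nat (Poly_Mapping.lookup e k) * AL_exps A r ! (k - 2)) 1)"
      using assms by (intro prod.cong) (auto simp: AL_args_eq single_power)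
    also have "\<dots> = Poly_Mapping.single
        (\<Sum>k=2..R. of_nat (Poly_Mapping.lookup e k) * AL_exps A r ! (k - 2)) 1"
      by (rule prod_single)
    finally show ?thesis .
  qed
  then show ?thesis
    unfolding AL_trunc_def msubst_mconst_sum_single sum_distrib_left
    by (intro sum.cong refl) (simp add: mconst_def mult_single)
qed

theorem theorem6p5:
  fixes f :: "'k::field poly"
    and lam :: "nat \<Rightarrow> 'k alg_closure"
    and A :: "nat \<Rightarrow> nat"
    and p N r s n' R :: nat
    and j l d' :: int
    and a' c' :: rat
    and Q :: "rat mpol"
  assumes "perfect_field TYPE('k)"
    and "CHAR('k) = p" and "p > 0"
    and "N \<ge> 1" and "\<not> p dvd N"
    and "r \<ge> 1"
    and "\<forall>k\<le>r. A k \<ge> 1"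
    and "Gcd (insert N (A ` {0..r})) = 1"
    and "inj_on lam {2..r}" and "0 \<notin> lam ` {2..r}" and "1 \<notin> lam ` {2..r}"
    and "map_poly to_ac f =
           [:0, 1:] ^ A 0 * [:-1, 1:] ^ A 1 * (\<Prod>k=2..r. [:- lam k, 1:] ^ A k)"
    and "1 \<le> s" and "s \<le> N - 1"
    and "n' = n_prime p N s"
    and "j \<ge> 1"
    and "a' > 0"
    and "rat_cong p a' (of_nat s * of_nat (Polynomial.degree f) / of_nat N - of_int j)"
    and "c' = a' + 1 - of_nat s / of_nat N"
    and "\<lceil>of_int j / of_nat p - 1 :: rat\<rceil> \<le> l"
    and "l \<le> \<lfloor>(of_nat n' * of_nat (Polynomial.degree f) + of_int j) / of_nat p - 1 :: rat\<rfloor>"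
    and "d' = int n' * int (Polynomial.degree f) - (l + 1) * int p + j"
    and "R = (\<Sum>k=1..r. A k)"
    and "Q = mconst (pochhammer c' (nat d') / pochhammer a' (nat d')) *
           msubst mconst (\<lambda>k. AL_args A r ! (k - 2))
             (AL_trunc R d' (\<lambda>_. int n') a' (\<lambda>_. of_nat s / of_nat N) c')"
  shows "(\<forall>e. p_integral p (Poly_Mapping.lookup Q e)) \<and>
         to_ac (Polynomial.coeff (f ^ n') (nat ((l + 1) * int p - j))) = msubst red_rat lam Q"
proof -
  define F where "F = map_poly to_ac f"
  define D where "D = Polynomial.degree f"
  define b :: rat where "b = of_nat s / of_nat N"
  have CHAR: "p = CHAR('k alg_closure)" using assms(2) by simp
  have p: "prime p" using prime_CHAR_semidom[where 'a = 'k] assms(2,3) by simp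
  note red = CHAR p
  have p0: "of_nat p = (0 :: 'k alg_closure)" unfolding CHAR by (rule of_nat_CHAR)
  have "coprime p N" using p assms(5) by (rule prime_imp_coprime)
  note n'_spec = n_prime_spec[OF this \<open>p > 0\<close> assms(13,14), folded assms(15)]
  obtain m where m: "int m * int p - int n' * int N = int s" using n'_spec(2) by blast
  have N_nz: "(of_nat N :: 'k alg_closure) \<noteq> 0"
    using assms(5) CHAR by (simp add: of_nat_eq_0_iff_char_dvd)

  \<comment> \<open>Residues and signs of the parameters\<close>
  have b_int: "p_integral p b"
    unfolding b_def using p_integralI[OF p, of "int N" "int s"] assms(5) by simp
  have red_b: "red_rat b = (- of_nat n' :: 'k alg_closure)"
  proof -
    have "red_rat b = (of_nat s / of_nat N :: 'k alg_closure)"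
      unfolding b_def using red_rat_divide[of "int N" "int s", where 'a = "'k alg_closure"] N_nz
      by simp
    \<comment> \<open>Modulo p the equation m p - n' N = s loses its first term.\<close>
    also have "(of_nat s :: 'k alg_closure) = - (of_nat n' * of_nat N)"
      using arg_cong[OF m, of "of_int :: int \<Rightarrow> 'k alg_closure", symmetric] p0 by simp
    finally show ?thesis using N_nz by simp
  qed
  have "s < N" using assms(13,14) by linarith
  then have "of_nat s / of_nat N < (1 :: rat)" by simp
  then have c'_pos: "c' > 0" using assms(17) by (simp add: assms(19))

  \<comment> \<open>The lower bound on l makes the index (l + 1) p - j nonnegative, the upper bound
    makes d' nonnegative; so \<open>nat\<close> alters neither.\<close>
  have "of_int j / of_nat p - 1 \<le> (of_int l :: rat)" using assms(20) by linarith
  then have "of_int j \<le> (of_int ((l + 1) * int p) :: rat)"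
    using assms(3) by (simp add: field_simps)
  then have jl: "j \<le> (l + 1) * int p" by (simp only: of_int_le_iff)
  have "of_int l \<le> (of_nat n' * of_nat D + of_int j) / of_nat p - (1 :: rat)"
    using assms(21) unfolding D_def by linarith
  then have "of_int ((l + 1) * int p) \<le> (of_int (int n' * int D + j) :: rat)"
    using assms(3) by (simp add: field_simps)
  then have d'_nonneg: "d' \<ge> 0" unfolding assms(22) D_def of_int_le_iff by simp
  define d where "d = nat d'"
  have d: "d' = int d" using d'_nonneg by (simp add: d_def)
  define M where "M = nat ((l + 1) * int p - j)"
  have dM: "d + M = n' * D"
  proof -
    have "int (d + M) = int (n' * D)"
      using jl d'_nonneg unfolding d_def M_def assms(22) D_def by simp
    then show ?thesis unfolding of_nat_eq_iff .
  qed

  have red_a: "p_integral p a'" "red_rat a' = (- of_nat d :: 'k alg_closure)"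
  proof -
    show "p_integral p a'" using assms(18) by (simp add: rat_cong_def)
    have eq: "of_nat s * of_nat D / of_nat N - of_int j = b * of_nat D + of_int (- j)"
      by (simp add: b_def)
    have "red_rat a' = (red_rat (b * of_nat D + of_int (- j)) :: 'k alg_closure)"
      using rat_cong_imp_red_rat_eq[OF red assms(18)] unfolding D_def[symmetric] eq .
    also have "\<dots> = - of_nat n' * of_nat D - of_int j"
      by (simp only: red_rat_add[OF red] red_rat_mult[OF red] p_integral_mult[OF p] b_int
          p_integral_of_nat p_integral_of_int red_rat_of_nat red_rat_of_int red_b) simp
    \<comment> \<open>By definition d' differs from n' D + j by a multiple of p.\<close>
    also have "\<dots> = - of_int d'"
      using p0 by (simp add: assms(22) D_def)
    finally show "red_rat a' = (- of_nat d :: 'k alg_closure)" by (simp add: d)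
  qed

  \<comment> \<open>The specialized series as a sum of monomials\<close>
  let ?T = "AL_trunc_exps R (int d) (\<lambda>_. int n')"
  \<comment> \<open>The exponent vector of the monomial substituted for z_k.\<close>
  define \<mu> where "\<mu> k = AL_exps A r ! (k - 2)" for k
  define C where "C e = pochhammer c' d / pochhammer a' d * AL_coeff R a' (\<lambda>_. b) c' e" for e
  have A1: "A 1 \<ge> 1" using assms(6,7) by simp
  have "length (AL_exps A r) = R - 1"
    using A1 assms(6) by (simp add: assms(23) length_AL_exps sum.atLeast_Suc_atMost numeral_2_eq_2)
  then have Q: "Q = (\<Sum>e\<in>?T. Poly_Mapping.single
      (\<Sum>k=2..R. of_nat (Poly_Mapping.lookup e k) * \<mu> k) (C e))"
    unfolding assms(24) d nat_int b_def[symmetric] \<mu>_def C_def by (rule msubst_mconst_AL_trunc)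
  have C: "p_integral p (C e)"
    "red_rat (C e) = (neg_binom n' (d - sum (Poly_Mapping.lookup e) {2..R}) *
      (\<Prod>k=2..R. neg_binom n' (Poly_Mapping.lookup e k)) :: 'k alg_closure)"
    if "e \<in> ?T" for e
  proof -
    have S: "sum (Poly_Mapping.lookup e) {2..R} \<le> d" "d \<le> n' + sum (Poly_Mapping.lookup e) {2..R}"
      and le: "\<And>k. k \<in> {2..R} \<Longrightarrow> Poly_Mapping.lookup e k \<le> n'"
      using that by (auto simp: AL_trunc_exps_def simp del: of_nat_sum)
    note * = red_rat_AL_coeff[where I = "{2..R}" and e = "Poly_Mapping.lookup e",
        OF red n'_spec(1) b_int red_b red_a assms(19)[folded b_def] assms(17) c'_pos S le]
    show "p_integral p (C e)"
      unfolding C_def AL_coeff_def by (rule *(1))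
    show "red_rat (C e) = (neg_binom n' (d - sum (Poly_Mapping.lookup e) {2..R}) *
        (\<Prod>k=2..R. neg_binom n' (Poly_Mapping.lookup e k)) :: 'k alg_closure)"
      unfolding C_def AL_coeff_def by (rule *(2))
  qed

  \<comment> \<open>Comparison with the coefficient of the power of f\<close>
  have "to_ac (Polynomial.coeff (f ^ n') M) = Polynomial.coeff (F ^ n') M"
    by (simp add: to_ac_coeff_power F_def)
  also have "\<dots> = Polynomial.coeff (reflect_poly (F ^ n')) d"
  proof -
    have "Polynomial.degree (F ^ n') = n' * D"
    proof -
      have "D = Polynomial.degree F" by (simp add: D_def F_def)
      \<comment> \<open>\<open>degree_power_eq\<close> assumes a nonzero base; for F = 0 both
        degrees are 0.\<close>
      then show ?thesis by (cases "F = 0") (simp_all add: degree_power_eq power_0_left)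
    qed
    moreover have "\<not> n' * D < d" "n' * D - d = M" using dM by linarith+
    ultimately show ?thesis by (simp add: coeff_reflect_poly)
  qed
  also have "\<dots> = (\<Sum>g | g \<in> {2..R} \<rightarrow>\<^sub>E {..n'} \<and> sum g {2..R} \<le> d \<and> d \<le> n' + sum g {2..R}.
      neg_binom n' (d - sum g {2..R}) *
      (\<Prod>k=2..R. neg_binom n' (g k) * mono_eval lam (\<mu> k) ^ g k))"
    unfolding F_def assms(12) reflect_poly_product_linear_power[OF A1 assms(6,23)] \<mu>_def
    by (rule coeff_prod_linear_power) simp
  also have "\<dots> = (\<Sum>e\<in>?T. neg_binom n' (d - sum (Poly_Mapping.lookup e) {2..R}) *
      (\<Prod>k=2..R. neg_binom n' (Poly_Mapping.lookup e k) *
        mono_eval lam (\<mu> k) ^ Poly_Mapping.lookup e k))"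
    \<comment> \<open>The remaining premise says that the summand sees g only on {2..R}.\<close>
    by (rule sum_AL_trunc_exps[symmetric])
       (intro arg_cong2[where f = "(*)"] arg_cong[where f = "\<lambda>S. neg_binom n' (d - S)"]
         sum.cong prod.cong refl, simp_all)
  also have "\<dots> = (\<Sum>e\<in>?T. red_rat (C e) *
      mono_eval lam (\<Sum>k=2..R. of_nat (Poly_Mapping.lookup e k) * \<mu> k))"
    by (intro sum.cong refl) (simp add: C(2) mono_eval_sum mono_eval_of_nat_mult prod.distrib mult.assoc)
  also have "\<dots> = msubst red_rat lam Q"
    unfolding Q by (rule msubst_red_rat_sum_single[OF red C(1), symmetric])
  finally have "to_ac (Polynomial.coeff (f ^ n') M) = msubst red_rat lam Q" .
  moreover have "p_integral p (Poly_Mapping.lookup Q e)" for e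
    unfolding Q by (rule p_integral_lookup_sum_single[OF p C(1)])
  ultimately show ?thesis by (simp add: M_def)
qed

end
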